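(* Let $(M,\Phi)$ be a uniformly expanding NAIFS on a compact Riemannian manifold $M$ with uniform expansion factor $\sigma>1$ and injectivity constant $\rho>0$. Then $(M,\Phi)$ is $\ast$-expansive.
   Context: NAIFS: A non-autonomous iterated function system (NAIFS) on $M$ is a pair $(M,\Phi)$ where $\Phi=\{\Phi^{(j)}\}_{j\ge 1}$, $\Phi^{(j)}=\{\varphi_i^{(j)}:M\to M\}_{i\in I^{(j)}}$ is a collection of maps and $I^{(j)}$ is a non-empty finite index set. For $m,n\ge1$ put $I^{m,n}:=\prod_{j=0}^{n-1}I^{(m+j)}$ (words $w=w_m\cdots w_{m+n-1}$). For $w\in I^{m,n}$ and $1\le k\le n$ put $\varphi_w^{m,k}:=\varphi_{w_{m+k-1}}^{(m+k-1)}\circ\cdots\circ\varphi_{w_m}^{(m)}$, $\varphi_w^{m,0}:=\mathrm{id}_M$. Let $d$ be the Riemannian distance on $M$, $B(p,r)$ the open ball, and for $w\in I^{m,n}$ let $d_{w,n}(x,y):=\max_{0\le j\le n}d(\varphi_w^{m,j}(x),\varphi_w^{m,j}(y))$. Expanding maps: a $C^1$-local diffeomorphism $f:M\to M$ is expanding if there are $\sigma>1$ and some Riemannian metric on $M$ with $\|Df(x)v\|\ge\sigma\|v\|$ for every $x\in M$ and every tangent vector $v$ at $x$. For $\sigma>1$, $\rho>0$, $\mathcal E(\sigma,\rho)$ denotes the set of all expanding $C^1$-local diffeomorphisms $f$ of $M$ with expansion factor $\sigma$ and injectivity constant $\rho$, meaning: for every $p\in M$ the image $f(B(p,\rho))$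 contains a neighbourhood of the closure of $B(f(p),\rho)$ and $d(f(x),f(y))\ge\sigma d(x,y)$ for all $x,y\in B(p,\rho)$; moreover, for any pre-image $x$ of any point $y\in M$ there is a $C^1$ map $h:B(y,\rho)\to M$ (inverse branch) with $f\circ h=\mathrm{id}$, $h(y)=x$ and $d(h(y_1),h(y_2))\le\sigma^{-1}d(y_1,y_2)$ for all $y_1,y_2\in B(y,\rho)$. Uniformly expanding: $(M,\Phi)$ is uniformly expanding with uniform expansion factor $\sigma$ and injectivity constant $\rho$ if $\varphi_i^{(j)}\in\mathcal E(\sigma,\rho)$ for all $j\ge1$, $i\in I^{(j)}$. Expansivity: for $\delta>0$, $(M,\Phi)$ is $\delta$-expansive if for any $\gamma>0$ there exists $k_0\ge1$ (depending on $\gamma$) such that for any $x,y\in M$ with $d(x,y)\ge\gamma$ one has $d_{w,n}(x,y)>\delta$ for each $w\in I^{m,n}$ with $m\ge1$ and $n\ge k_0$. It is $\ast$-expansive if it is $\delta$-expansive for some $\delta>0$. *)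

theory Defs
  imports "HOL-Analysis.Analysis"
begin

section \<open>Smooth manifolds\<close>

text \<open>
  Meaningful for open \<open>S\<close>. In finite dimension, being \<open>C\<^sup>k\<close> amounts to the iterated
  directional derivatives up to order \<open>k\<close> existing and being continuous.
\<close>

primrec Ck_on :: "nat \<Rightarrow> 'a::real_normed_vector set \<Rightarrow> ('a \<Rightarrow> 'b::real_normed_vector) \<Rightarrow> bool" where
  "Ck_on 0 S f \<longleftrightarrow> continuous_on S f"
| "Ck_on (Suc k) S f \<longleftrightarrow>
     (\<forall>x\<in>S. f differentiable (at x)) \<and> (\<forall>v. Ck_on k S (\<lambda>x. frechet_derivative f (at x) v))"

definition smooth_on :: "'a::real_normed_vector set \<Rightarrow> ('a \<Rightarrow> 'b::real_normed_vector) \<Rightarrow> bool" where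
  "smooth_on S f \<longleftrightarrow> (\<forall>k. Ck_on k S f)"

text \<open>
  The manifold is the whole type \<open>'m\<close>, modelled on the Euclidean space \<open>'e\<close>. A chart is a
  pair of a domain and a coordinate map; the map is irrelevant outside the domain.
\<close>

type_synonym ('m, 'e) chart = "'m set \<times> ('m \<Rightarrow> 'e)"

definition is_chart :: "('m::topological_space, 'e::euclidean_space) chart \<Rightarrow> bool" where
  "is_chart c \<longleftrightarrow> open (fst c) \<and> open (snd c ` fst c) \<and>
     (\<exists>\<psi>. homeomorphism (fst c) (snd c ` fst c) (snd c) \<psi>)"

definition chart_inv :: "('m, 'e) chart \<Rightarrow> 'e \<Rightarrow> 'm" where
  "chart_inv c = inv_into (fst c) (snd c)"

definition smooth_atlas :: "('m::topological_space, 'e::euclidean_space) chart set \<Rightarrow> bool" where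
  "smooth_atlas A \<longleftrightarrow>
     (\<forall>c\<in>A. is_chart c) \<and> (\<Union>c\<in>A. fst c) = UNIV \<and>
     (\<forall>c\<in>A. \<forall>c'\<in>A. smooth_on (snd c ` (fst c \<inter> fst c')) (snd c' \<circ> chart_inv c))"

text \<open>\<open>S\<close> is meant to be open.\<close>

definition C1_map_on ::
  "('m::topological_space, 'e::euclidean_space) chart set \<Rightarrow> 'm set \<Rightarrow> ('m \<Rightarrow> 'm) \<Rightarrow> bool" where
  "C1_map_on A S f \<longleftrightarrow> continuous_on S f \<and>
     (\<forall>c\<in>A. \<forall>c'\<in>A. Ck_on 1 (snd c ` {x \<in> fst c \<inter> S. f x \<in> fst c'}) (snd c' \<circ> f \<circ> chart_inv c))"

definition C1_local_diffeo ::
  "('m::topological_space, 'e::euclidean_space) chart set \<Rightarrow> ('m \<Rightarrow> 'm) \<Rightarrow> bool" where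
  "C1_local_diffeo A f \<longleftrightarrow>
     (\<forall>x. \<exists>U V h. open U \<and> open V \<and> x \<in> U \<and> homeomorphism U V f h \<and>
        C1_map_on A U f \<and> C1_map_on A V h)"


section \<open>Tangent vectors and Riemannian metrics\<close>

text \<open>
  The tangent space at \<open>p\<close> is identified with \<open>'e\<close> through one chart \<open>chart_at A p\<close>, chosen once
  and for all for each \<open>p\<close>. Derivatives, velocities and metrics are expressed in these
  coordinates. The choice need not depend continuously on \<open>p\<close>, so smoothness of a metric is
  tested after changing coordinates to a fixed chart.
\<close>

definition chart_at :: "('m, 'e) chart set \<Rightarrow> 'm \<Rightarrow> ('m, 'e) chart" where
  "chart_at A p = (SOME c. c \<in> A \<and> p \<in> fst c)"

definition mderiv ::
  "('m, 'e::euclidean_space) chart set \<Rightarrow> ('m \<Rightarrow> 'm) \<Rightarrow> 'm \<Rightarrow> 'e \<Rightarrow> 'e" where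
  "mderiv A f x v =
     frechet_derivative (snd (chart_at A (f x)) \<circ> f \<circ> chart_inv (chart_at A x))
       (at (snd (chart_at A x) x)) v"

definition tangent_of_coords ::
  "('m, 'e::euclidean_space) chart set \<Rightarrow> ('m, 'e) chart \<Rightarrow> 'm \<Rightarrow> 'e \<Rightarrow> 'e" where
  "tangent_of_coords A c p v =
     frechet_derivative (snd (chart_at A p) \<circ> chart_inv c) (at (snd c p)) v"

definition riemannian_metric ::
  "('m::topological_space, 'e::euclidean_space) chart set \<Rightarrow> ('m \<Rightarrow> 'e \<Rightarrow> 'e \<Rightarrow> real) \<Rightarrow> bool" where
  "riemannian_metric A g \<longleftrightarrow>
     (\<forall>p. bilinear (g p) \<and> (\<forall>v w. g p v w = g p w v) \<and> (\<forall>v. v \<noteq> 0 \<longrightarrow> g p v v > 0)) \<and>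
     (\<forall>c\<in>A. \<forall>v w. smooth_on (snd c ` fst c)
        (\<lambda>y. g (chart_inv c y) (tangent_of_coords A c (chart_inv c y) v)
                                (tangent_of_coords A c (chart_inv c y) w)))"

definition tnorm :: "('m \<Rightarrow> 'e \<Rightarrow> 'e \<Rightarrow> real) \<Rightarrow> 'm \<Rightarrow> 'e \<Rightarrow> real" where
  "tnorm g p v = sqrt (g p v v)"


section \<open>Riemannian distance\<close>

text \<open>One-sided derivatives are used at \<open>a\<close> and \<open>b\<close>.\<close>

definition C1_curve_on ::
  "('m::topological_space, 'e::euclidean_space) chart set \<Rightarrow> real \<Rightarrow> real \<Rightarrow> (real \<Rightarrow> 'm) \<Rightarrow> bool" where
  "C1_curve_on A a b \<gamma> \<longleftrightarrow> continuous_on {a..b} \<gamma> \<and>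
     (\<forall>c\<in>A. \<exists>D. continuous_on {t\<in>{a..b}. \<gamma> t \<in> fst c} D \<and>
        (\<forall>t\<in>{a..b}. \<gamma> t \<in> fst c \<longrightarrow>
           ((snd c \<circ> \<gamma>) has_vector_derivative D t) (at t within {a..b})))"

text \<open>\<open>S\<close> is the set of subdivision points of \<open>[0,1]\<close>.\<close>

definition piecewise_C1_curve ::
  "('m::topological_space, 'e::euclidean_space) chart set \<Rightarrow> (real \<Rightarrow> 'm) \<Rightarrow> bool" where
  "piecewise_C1_curve A \<gamma> \<longleftrightarrow>
     (\<exists>S. finite S \<and> {0, 1} \<subseteq> S \<and> S \<subseteq> {0..1} \<and>
        (\<forall>a\<in>S. \<forall>b\<in>S. a < b \<and> S \<inter> {a<..<b} = {} \<longrightarrow> C1_curve_on A a b \<gamma>))"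

definition velocity ::
  "('m, 'e::euclidean_space) chart set \<Rightarrow> (real \<Rightarrow> 'm) \<Rightarrow> real \<Rightarrow> 'e" where
  "velocity A \<gamma> t = vector_derivative (snd (chart_at A (\<gamma> t)) \<circ> \<gamma>) (at t)"

text \<open>
  The velocity may be undefined at the finitely many subdivision points, which do not
  contribute to the integral.
\<close>

definition curve_length ::
  "('m, 'e::euclidean_space) chart set \<Rightarrow> ('m \<Rightarrow> 'e \<Rightarrow> 'e \<Rightarrow> real) \<Rightarrow> (real \<Rightarrow> 'm) \<Rightarrow> ennreal" where
  "curve_length A g \<gamma> =
     (\<integral>\<^sup>+ t. ennreal (tnorm g (\<gamma> t) (velocity A \<gamma> t)) * indicator {0..1} t \<partial>lborel)"

text \<open>
  The manifold is not required to be connected: points in different components are at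
  distance \<open>\<infinity>\<close> (the infimum of the empty set).
\<close>

definition rdist ::
  "('m::topological_space, 'e::euclidean_space) chart set \<Rightarrow> ('m \<Rightarrow> 'e \<Rightarrow> 'e \<Rightarrow> real) \<Rightarrow>
   'm \<Rightarrow> 'm \<Rightarrow> ennreal" where
  "rdist A g x y =
     (INF \<gamma>\<in>{\<gamma>. piecewise_C1_curve A \<gamma> \<and> \<gamma> 0 = x \<and> \<gamma> 1 = y}. curve_length A g \<gamma>)"

definition rball ::
  "('m::topological_space, 'e::euclidean_space) chart set \<Rightarrow> ('m \<Rightarrow> 'e \<Rightarrow> 'e \<Rightarrow> real) \<Rightarrow>
   'm \<Rightarrow> real \<Rightarrow> 'm set" where
  "rball A g p r = {x. rdist A g p x < ennreal r}"


section \<open>Expanding maps\<close>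

text \<open>The metric \<open>g\<close> here need not be the one that defines the distance on the manifold.\<close>

definition expanding ::
  "('m::topological_space, 'e::euclidean_space) chart set \<Rightarrow> ('m \<Rightarrow> 'm) \<Rightarrow> bool" where
  "expanding A f \<longleftrightarrow> C1_local_diffeo A f \<and>
     (\<exists>\<sigma>>1. \<exists>g. riemannian_metric A g \<and>
        (\<forall>x v. tnorm g (f x) (mderiv A f x v) \<ge> \<sigma> * tnorm g x v))"

definition expanding_class ::
  "('m::topological_space, 'e::euclidean_space) chart set \<Rightarrow> ('m \<Rightarrow> 'e \<Rightarrow> 'e \<Rightarrow> real) \<Rightarrow>
   real \<Rightarrow> real \<Rightarrow> ('m \<Rightarrow> 'm) set" where
  "expanding_class A g \<sigma> \<rho> = {f. expanding A f \<and>
     (\<forall>p. closure (rball A g (f p) \<rho>) \<subseteq> interior (f ` rball A g p \<rho>) \<and>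
        (\<forall>x\<in>rball A g p \<rho>. \<forall>y\<in>rball A g p \<rho>.
           rdist A g (f x) (f y) \<ge> ennreal \<sigma> * rdist A g x y)) \<and>
     (\<forall>x y. f x = y \<longrightarrow>
        (\<exists>h. C1_map_on A (rball A g y \<rho>) h \<and> (\<forall>z\<in>rball A g y \<rho>. f (h z) = z) \<and> h y = x \<and>
           (\<forall>y1\<in>rball A g y \<rho>. \<forall>y2\<in>rball A g y \<rho>.
              rdist A g (h y1) (h y2) \<le> ennreal (1 / \<sigma>) * rdist A g y1 y2)))}"


section \<open>Non-autonomous iterated function systems\<close>

text \<open>
  \<open>I j\<close> and \<open>\<Phi> j i\<close> are only relevant for \<open>j \<ge> 1\<close> and \<open>i \<in> I j\<close>. A word in \<open>I\<^sup>m\<^sup>,\<^sup>n\<close> is a function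
  on the positions \<open>m, \<dots>, m + n - 1\<close>.
\<close>

definition naifs :: "(nat \<Rightarrow> 'i set) \<Rightarrow> bool" where
  "naifs I \<longleftrightarrow> (\<forall>j\<ge>1. finite (I j) \<and> I j \<noteq> {})"

definition words :: "(nat \<Rightarrow> 'i set) \<Rightarrow> nat \<Rightarrow> nat \<Rightarrow> (nat \<Rightarrow> 'i) set" where
  "words I m n = (\<Pi>\<^sub>E j\<in>{m..<m + n}. I j)"

primrec word_comp :: "(nat \<Rightarrow> 'i \<Rightarrow> 'm \<Rightarrow> 'm) \<Rightarrow> (nat \<Rightarrow> 'i) \<Rightarrow> nat \<Rightarrow> nat \<Rightarrow> 'm \<Rightarrow> 'm" where
  "word_comp \<Phi> w m 0 = id"
| "word_comp \<Phi> w m (Suc k) = \<Phi> (m + k) (w (m + k)) \<circ> word_comp \<Phi> w m k"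

definition bowen_dist ::
  "('m \<Rightarrow> 'm \<Rightarrow> ennreal) \<Rightarrow> (nat \<Rightarrow> 'i \<Rightarrow> 'm \<Rightarrow> 'm) \<Rightarrow> nat \<Rightarrow> (nat \<Rightarrow> 'i) \<Rightarrow> nat \<Rightarrow> 'm \<Rightarrow> 'm \<Rightarrow> ennreal"
  where
  "bowen_dist d \<Phi> m w n x y = Max ((\<lambda>j. d (word_comp \<Phi> w m j x) (word_comp \<Phi> w m j y)) ` {0..n})"

definition uniformly_expanding ::
  "('m::topological_space, 'e::euclidean_space) chart set \<Rightarrow> ('m \<Rightarrow> 'e \<Rightarrow> 'e \<Rightarrow> real) \<Rightarrow>
   (nat \<Rightarrow> 'i set) \<Rightarrow> (nat \<Rightarrow> 'i \<Rightarrow> 'm \<Rightarrow> 'm) \<Rightarrow> real \<Rightarrow> real \<Rightarrow> bool" where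
  "uniformly_expanding A g I \<Phi> \<sigma> \<rho> \<longleftrightarrow> (\<forall>j\<ge>1. \<forall>i\<in>I j. \<Phi> j i \<in> expanding_class A g \<sigma> \<rho>)"

definition delta_expansive ::
  "('m \<Rightarrow> 'm \<Rightarrow> ennreal) \<Rightarrow> (nat \<Rightarrow> 'i set) \<Rightarrow> (nat \<Rightarrow> 'i \<Rightarrow> 'm \<Rightarrow> 'm) \<Rightarrow> real \<Rightarrow> bool" where
  "delta_expansive d I \<Phi> \<delta> \<longleftrightarrow>
     (\<forall>\<gamma>::real. \<gamma> > 0 \<longrightarrow> (\<exists>k0\<ge>1. \<forall>x y. d x y \<ge> ennreal \<gamma> \<longrightarrow>
        (\<forall>m\<ge>1. \<forall>n\<ge>k0. \<forall>w\<in>words I m n. bowen_dist d \<Phi> m w n x y > ennreal \<delta>)))"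

definition star_expansive ::
  "('m \<Rightarrow> 'm \<Rightarrow> ennreal) \<Rightarrow> (nat \<Rightarrow> 'i set) \<Rightarrow> (nat \<Rightarrow> 'i \<Rightarrow> 'm \<Rightarrow> 'm) \<Rightarrow> bool" where
  "star_expansive d I \<Phi> \<longleftrightarrow> (\<exists>\<delta>>0. delta_expansive d I \<Phi> \<delta>)"

end

theory Submission
  imports Defs
begin

text \<open>
  A member of the class with factor \<open>\<sigma>\<close> and injectivity constant \<open>\<rho>\<close> stretches distances on
  every ball of radius \<open>\<rho>\<close>, so it stretches by \<open>\<sigma>\<close> the distance of any two points less than \<open>\<rho>\<close>
  apart: take the ball around one of them. Two orbits driven by the same word therefore cannot
  stay within \<open>\<rho> / 2\<close> of each other for long: as long as they do, their distance grows
  at least like \<open>\<sigma> ^ k\<close>. If it starts at \<open>\<gamma>\<close> or more, it exceeds \<open>\<rho> / 2\<close> by the time \<open>k0\<close> with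
  \<open>\<sigma> ^ k0 * \<gamma> > \<rho> / 2\<close>. This \<open>k0\<close> depends on neither the points nor the word, because the
  constants \<open>\<sigma>\<close> and \<open>\<rho>\<close> are common to all the maps.

  The growth argument is \<open>star_expansive_if_locally_expanding\<close>, for an arbitrary locally
  stretched function of two points. It applies to the Riemannian distance by
  \<open>expanding_class_expands\<close>, where the constant curve shows that a point lies in the ball around
  itself.
\<close>

lemma rdist_refl:
  fixes A :: "('m::topological_space, 'e::euclidean_space) chart set"
  assumes "riemannian_metric A g"
  shows "rdist A g x x = 0"
proof -
  let ?c = "\<lambda>_::real. x"
  have "C1_curve_on A a b ?c" for a b
    by (auto simp: C1_curve_on_def o_def intro!: exI[of _ "\<lambda>_. 0"])
  then have curve: "piecewise_C1_curve A ?c"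
    by (auto simp: piecewise_C1_curve_def intro!: exI[of _ "{0, 1}"])
  have "bilinear (g x)"
    using assms by (simp add: riemannian_metric_def)
  then have "g x 0 0 = 0"
    by (rule bilinear_lzero)
  then have "curve_length A g ?c = 0"
    by (simp add: curve_length_def velocity_def tnorm_def o_def)
  with curve have "rdist A g x x \<le> 0"
    unfolding rdist_def by (intro INF_lower2[of ?c]) auto
  then show ?thesis by simp
qed

lemma expanding_class_expands:
  fixes A :: "('m::topological_space, 'e::euclidean_space) chart set"
  assumes "riemannian_metric A g" "\<rho> > 0" "f \<in> expanding_class A g \<sigma> \<rho>"
    and "rdist A g x y < ennreal \<rho>"
  shows "ennreal \<sigma> * rdist A g x y \<le> rdist A g (f x) (f y)"
proof -
  have "x \<in> rball A g x \<rho>" "y \<in> rball A g x \<rho>"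
    using assms by (simp_all add: rball_def rdist_refl)
  with assms(3) show ?thesis
    unfolding expanding_class_def by blast
qed

text \<open>
  The distance at time \<open>k\<close> need not be small: the stretching that produces it uses closeness at
  the earlier times only.
\<close>

lemma word_comp_expands:
  fixes d :: "'m \<Rightarrow> 'm \<Rightarrow> ennreal"
  assumes expands: "\<And>j i x y. j \<ge> 1 \<Longrightarrow> i \<in> I j \<Longrightarrow> d x y < ennreal \<rho> \<Longrightarrow>
      ennreal \<sigma> * d x y \<le> d (\<Phi> j i x) (\<Phi> j i y)"
    and "m \<ge> 1" "w \<in> words I m n" "k \<le> n"
    and "\<And>j. j < k \<Longrightarrow> d (word_comp \<Phi> w m j x) (word_comp \<Phi> w m j y) < ennreal \<rho>"
  shows "ennreal \<sigma> ^ k * d x y \<le> d (word_comp \<Phi> w m k x) (word_comp \<Phi> w m k y)"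
  using assms(4,5)
proof (induction k)
  case 0
  then show ?case by simp
next
  case (Suc k)
  let ?x = "word_comp \<Phi> w m k x" and ?y = "word_comp \<Phi> w m k y"
  have letter: "w (m + k) \<in> I (m + k)"
    using assms(3) Suc.prems(1) by (auto simp: words_def PiE_iff)
  have "ennreal \<sigma> ^ Suc k * d x y = ennreal \<sigma> * (ennreal \<sigma> ^ k * d x y)"
    by (simp add: mult.assoc)
  also have "\<dots> \<le> ennreal \<sigma> * d ?x ?y"
    using Suc by (intro mult_left_mono) auto
  also have "\<dots> \<le> d (\<Phi> (m + k) (w (m + k)) ?x) (\<Phi> (m + k) (w (m + k)) ?y)"
    using expands[OF _ letter] Suc.prems(2)[of k] assms(2) by simp
  finally show ?case by simp
qed

lemma star_expansive_if_locally_expanding: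
  fixes d :: "'m \<Rightarrow> 'm \<Rightarrow> ennreal"
  assumes "\<sigma> > 1" "\<rho> > 0"
    and expands: "\<And>j i x y. j \<ge> 1 \<Longrightarrow> i \<in> I j \<Longrightarrow> d x y < ennreal \<rho> \<Longrightarrow>
      ennreal \<sigma> * d x y \<le> d (\<Phi> j i x) (\<Phi> j i y)"
  shows "star_expansive d I \<Phi>"
proof -
  have "\<exists>k0\<ge>1. \<forall>x y. d x y \<ge> ennreal \<gamma> \<longrightarrow>
      (\<forall>m\<ge>1. \<forall>n\<ge>k0. \<forall>w\<in>words I m n. bowen_dist d \<Phi> m w n x y > ennreal (\<rho> / 2))"
    if "\<gamma> > 0" for \<gamma> :: real
  proof -
    obtain k where k: "\<rho> / 2 / \<gamma> < \<sigma> ^ k"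
      using real_arch_pow[OF \<open>\<sigma> > 1\<close>] by blast
    have "bowen_dist d \<Phi> m w n x y > ennreal (\<rho> / 2)"
      if xy: "d x y \<ge> ennreal \<gamma>" and m: "m \<ge> 1" and n: "n \<ge> Suc k" and w: "w \<in> words I m n"
      for x y m n w
    proof (rule ccontr)
      assume "\<not> ?thesis"
      then have close: "d (word_comp \<Phi> w m j x) (word_comp \<Phi> w m j y) \<le> ennreal (\<rho> / 2)"
        if "j \<le> n" for j
        using that by (simp add: bowen_dist_def not_less)
      \<comment> \<open>The balls of the stretching hypothesis are open, hence a threshold below \<open>\<rho>\<close>.\<close>
      have half: "ennreal (\<rho> / 2) < ennreal \<rho>"
        using \<open>\<rho> > 0\<close> by (simp add: ennreal_less_iff)
      have "\<sigma> ^ k \<le> \<sigma> ^ n"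
        using \<open>\<sigma> > 1\<close> n by (intro power_increasing) auto
      with k have "\<rho> / 2 / \<gamma> < \<sigma> ^ n"
        by linarith
      then have "\<rho> / 2 < \<sigma> ^ n * \<gamma>"
        using \<open>\<gamma> > 0\<close> by (simp add: pos_divide_less_eq)
      then have "ennreal (\<rho> / 2) < ennreal (\<sigma> ^ n * \<gamma>)"
        using \<open>\<rho> > 0\<close> by (simp add: ennreal_less_iff)
      also have "\<dots> = ennreal \<sigma> ^ n * ennreal \<gamma>"
        using \<open>\<sigma> > 1\<close> \<open>\<gamma> > 0\<close> by (simp add: ennreal_mult ennreal_power)
      also have "\<dots> \<le> ennreal \<sigma> ^ n * d x y"
        using xy by (intro mult_left_mono) auto
      also have "\<dots> \<le> d (word_comp \<Phi> w m n x) (word_comp \<Phi> w m n y)"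
        using expands m w
      proof (rule word_comp_expands)
        fix j assume "j < n"
        then show "d (word_comp \<Phi> w m j x) (word_comp \<Phi> w m j y) < ennreal \<rho>"
          using close[of j] half by (simp add: order.strict_trans1)
      qed auto
      also have "\<dots> \<le> ennreal (\<rho> / 2)"
        by (simp add: close)
      finally show False by simp
    qed
    \<comment> \<open>\<open>k\<close> may be \<open>0\<close>, while \<open>k0\<close> has to be positive.\<close>
    then show ?thesis
      by (intro exI[of _ "Suc k"]) simp
  qed
  then show ?thesis
    using \<open>\<rho> > 0\<close> unfolding star_expansive_def delta_expansive_def
    by (intro exI[of _ "\<rho> / 2"]) simp
qed

theorem proposition6p6:
  fixes A :: "('m::{t2_space, second_countable_topology}, 'e::euclidean_space) chart set"
    and g :: "'m \<Rightarrow> 'e \<Rightarrow> 'e \<Rightarrow> real"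
    and I :: "nat \<Rightarrow> 'i set"
    and \<Phi> :: "nat \<Rightarrow> 'i \<Rightarrow> 'm \<Rightarrow> 'm"
    and \<sigma> \<rho> :: real
  assumes "compact (UNIV :: 'm set)"
    and "smooth_atlas A"
    and "riemannian_metric A g"
    and "naifs I"
    and "\<sigma> > 1" and "\<rho> > 0"
    and "uniformly_expanding A g I \<Phi> \<sigma> \<rho>"
  shows "star_expansive (rdist A g) I \<Phi>"
  using assms(5,6)
proof (rule star_expansive_if_locally_expanding)
  fix j i x y
  assume "j \<ge> 1" "i \<in> I j" and close: "rdist A g x y < ennreal \<rho>"
  then have "\<Phi> j i \<in> expanding_class A g \<sigma> \<rho>"
    using assms(7) by (simp add: uniformly_expanding_def)
  then show "ennreal \<sigma> * rdist A g x y \<le> rdist A g (\<Phi> j i x) (\<Phi> j i y)"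
    using assms(3,6) close by (intro expanding_class_expands)
qed

end
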